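(* Let $\alpha\ge1$ and $1\le k<\ell$ be real numbers. Then \[ \binom{\alpha k}{k}^{-\frac1k}\lambda_{k,\alpha k}\;\le\;\binom{\alpha\ell}{\ell}^{-\frac1\ell}\lambda_{\ell,\alpha\ell}, \] where $\lambda_{k,n}$ denotes the first radial $(k,n)$-eigenvalue.
   Context: For real $0\le k\le n$, $\binom{n}{k}:=\frac{\Gamma(n+1)}{\Gamma(k+1)\Gamma(n-k+1)}$. For $\alpha\ge 1$, a function $u\in C^2(0,1)$ is called $\alpha$-convex if $\limsup_{r\to0}\frac{u'}{r}<\infty$, $u'\ge0$ and $u''+(\alpha-1)\frac{u'}{r}\ge0$ on $(0,1)$. For real $1\le k\le n$, set $\alpha=n/k$ and $S_{k,n}(u):=\binom{n-1}{k-1}\left(\frac{u'}{r}\right)^{k-1}\left(u''+\frac{n-k}{k}\frac{u'}{r}\right)$. An $\alpha$-convex function $u$ and a number $\lambda>0$ solve the radial $(k,n)$-eigenvalue problem if $S_{k,n}(u)=(-\lambda u)^k$ on $(0,1)$, $u(0)=-1$, $u(1)=0$ (endpoint values taken as limits). It is known that there is a unique such pair, denoted $(u_{k,n},\lambda_{k,n})$: the first radial $(k,n)$-eigenfunction and eigenvalue. It is also known that $\lambda_{k,n}^k=\inf\frac{E_{k,n}[u]}{I_{k,n}[u]}$, the infimum being over $\alpha$-convex $u$ with $u(1)=0$, $u(0)=-1$, where $E_{k,n}[u]=\frac1{k+1}\int_0^1(-u)S_{k,n}(u)\,r^{n-1}dr$ and $I_{k,n}[u]=\frac1{k+1}\int_0^1(-u)^{k+1}r^{n-1}dr$;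 the infimum is attained by $u_{k,n}$. *)

theory Defs
  imports "HOL-Analysis.Analysis"
begin

definition real_binomial :: "real \<Rightarrow> real \<Rightarrow> real" where
  "real_binomial n k = Gamma (n + 1) / (Gamma (k + 1) * Gamma (n - k + 1))"

text \<open>Since \<open>0 powr 0 = 0\<close> in the library, a zero exponent is treated separately, so that
  the factor $(u'/r)^{k-1}$ is identically 1 when $k = 1$, even where $u'$ vanishes.\<close>

definition rpow :: "real \<Rightarrow> real \<Rightarrow> real" where
  "rpow x a = (if a = 0 then 1 else x powr a)"

definition C2_on :: "real set \<Rightarrow> (real \<Rightarrow> real) \<Rightarrow> bool" where
  "C2_on A u \<longleftrightarrow> u differentiable_on A \<and> deriv u differentiable_on A \<and>
     continuous_on A (deriv (deriv u))"

definition alpha_convex :: "real \<Rightarrow> (real \<Rightarrow> real) \<Rightarrow> bool" where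
  "alpha_convex \<alpha> u \<longleftrightarrow>
     C2_on {0<..<1} u \<and>
     Limsup (at_right 0) (\<lambda>r. ereal (deriv u r / r)) < \<infinity> \<and>
     (\<forall>r\<in>{0<..<1}. deriv u r \<ge> 0 \<and>
        deriv (deriv u) r + (\<alpha> - 1) * (deriv u r / r) \<ge> 0)"

definition S_op :: "real \<Rightarrow> real \<Rightarrow> (real \<Rightarrow> real) \<Rightarrow> real \<Rightarrow> real" where
  "S_op k n u r = real_binomial (n - 1) (k - 1) * rpow (deriv u r / r) (k - 1) *
     (deriv (deriv u) r + (n - k) / k * (deriv u r / r))"

definition radial_eigenpair :: "real \<Rightarrow> real \<Rightarrow> (real \<Rightarrow> real) \<Rightarrow> real \<Rightarrow> bool" where
  "radial_eigenpair k n u lam \<longleftrightarrow>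
     alpha_convex (n / k) u \<and> lam > 0 \<and>
     (\<forall>r\<in>{0<..<1}. S_op k n u r = rpow (- lam * u r) k) \<and>
     (u \<longlongrightarrow> - 1) (at_right 0) \<and> (u \<longlongrightarrow> 0) (at_left 1)"

text \<open>For $1 \le k \le n$ there is exactly one such number; it is kept as a predicate so that
  no definite description is needed.\<close>

definition is_first_radial_eigenvalue :: "real \<Rightarrow> real \<Rightarrow> real \<Rightarrow> bool" where
  "is_first_radial_eigenvalue k n lam \<longleftrightarrow> (\<exists>u. radial_eigenpair k n u lam)"

end

theory Submission
  imports Defs
begin

text \<open>Put $w = -u$, $g = r^{\alpha-1} u'$ and $\mu = \binom{\alpha k}{k}^{-1/k} \lambda_{k,\alpha k}$. The
  eigenvalue equation becomes $(g^k)' = k \alpha\, r^{\alpha k - 1} (\mu w)^k$, so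
  $g^k \ge (r^\alpha \mu w)^k$ because $w$ decreases. Hence a solution $(z, h)$ for $\ell > k$ with
  normalised eigenvalue $\nu$ satisfies $(h^k)' \le k \alpha\, r^{\alpha k - 1} (\nu z)^k$. Comparing with the
  solution for $k$, a bound $z \le C w$ integrates (first from $0$, then from $1$) to
  $z \le C (\nu / \mu) w$. Some such $C$ exists, and iterating forces $z \le 0$ if $\nu < \mu$. This
  comparison replaces the variational characterisation of the eigenvalue.\<close>

section \<open>Signs of monotone functions from one-sided boundary limits\<close>

lemma nonneg_if_deriv_nonneg_tendsto_0:
  fixes h h' :: "real \<Rightarrow> real"
  assumes der: "\<And>r. 0 < r \<Longrightarrow> r < 1 \<Longrightarrow> (h has_real_derivative h' r) (at r)"
    and nonneg: "\<And>r. 0 < r \<Longrightarrow> r < 1 \<Longrightarrow> 0 \<le> h' r"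
    and lim: "(h \<longlongrightarrow> 0) (at_right 0)"
    and r: "0 < r" "r < 1"
  shows "0 \<le> h r"
proof -
  have "h s \<le> h r" if "0 < s" "s \<le> r" for s
    using that r by (intro DERIV_nonneg_imp_nondecreasing[OF that(2)]) (force intro: der nonneg)
  then have "eventually (\<lambda>s. h s \<le> h r) (at_right 0)"
    using r by (auto simp: eventually_at_right_field intro!: exI[of _ r])
  then show ?thesis
    using tendsto_upperbound[OF lim] by simp
qed

lemma nonpos_if_deriv_nonneg_tendsto_0:
  fixes h h' :: "real \<Rightarrow> real"
  assumes der: "\<And>r. 0 < r \<Longrightarrow> r < 1 \<Longrightarrow> (h has_real_derivative h' r) (at r)"
    and nonneg: "\<And>r. 0 < r \<Longrightarrow> r < 1 \<Longrightarrow> 0 \<le> h' r"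
    and lim: "(h \<longlongrightarrow> 0) (at_left 1)"
    and r: "0 < r" "r < 1"
  shows "h r \<le> 0"
proof -
  have "h r \<le> h s" if "r \<le> s" "s < 1" for s
    using that r by (intro DERIV_nonneg_imp_nondecreasing[OF that(1)]) (force intro: der nonneg)
  then have "eventually (\<lambda>s. h r \<le> h s) (at_left 1)"
    using r by (auto simp: eventually_at_left_field intro!: exI[of _ r])
  then show ?thesis
    using tendsto_lowerbound[OF lim] by simp
qed

lemma powr_tendsto_0_at_right:
  fixes c :: real
  assumes "0 < c"
  shows "((\<lambda>r. r powr c) \<longlongrightarrow> 0) (at_right 0)"
proof -
  \<comment> \<open>The base tends to 0, where \<open>powr\<close> is continuous only through
    nonnegative bases and for a positive exponent.\<close>
  have "eventually (\<lambda>r::real. 0 \<le> r) (at_right 0)"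
    by (auto simp: eventually_at_right_field intro!: exI[of _ 1])
  then show ?thesis
    using tendsto_powr'[OF tendsto_ident_at tendsto_const, of "0::real" c "{0<..}"] assms by simp
qed

lemma le_if_powr_le:
  fixes x y c :: real
  assumes "0 < c" "0 \<le> y" "x powr c \<le> y powr c"
  shows "x \<le> y"
  using assms powr_less_mono2[of c y x] by (meson not_le)

section \<open>The first-order system satisfied by one solution\<close>

text \<open>The eigenvalue equation as a system for \<open>w\<close> and its flux \<open>g\<close>.
  The equation for \<open>g\<close> is that for \<open>(g powr k)'\<close> divided by
  \<open>k * g powr (k - 1)\<close>, which is legitimate because \<open>g\<close> is positive. The
  binomial coefficient is absorbed into \<open>\<mu>\<close>.\<close>

locale radial_solution =
  fixes \<alpha> k \<mu> :: real and w g :: "real \<Rightarrow> real"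
  assumes alpha: "1 \<le> \<alpha>" and k: "1 \<le> k" and mu: "0 < \<mu>"
    and w_pos: "\<And>r. 0 < r \<Longrightarrow> r < 1 \<Longrightarrow> 0 < w r"
    and g_pos: "\<And>r. 0 < r \<Longrightarrow> r < 1 \<Longrightarrow> 0 < g r"
    and w_deriv: "\<And>r. 0 < r \<Longrightarrow> r < 1 \<Longrightarrow>
      (w has_real_derivative - (r powr (1 - \<alpha>) * g r)) (at r)"
    and g_deriv: "\<And>r. 0 < r \<Longrightarrow> r < 1 \<Longrightarrow>
      (g has_real_derivative \<alpha> * r powr (\<alpha> * k - 1) * (\<mu> * w r) powr k * g r powr (1 - k)) (at r)"
    and w_lim_0: "(w \<longlongrightarrow> 1) (at_right 0)"
    and w_lim_1: "(w \<longlongrightarrow> 0) (at_left 1)"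
    and g_lim_0: "(g \<longlongrightarrow> 0) (at_right 0)"
begin

lemma w_antimono:
  assumes "0 < r" "r \<le> s" "s < 1"
  shows "w s \<le> w r"
  using assms
  by (intro DERIV_nonpos_imp_nonincreasing[OF assms(2)])
     (force intro!: w_deriv simp: less_imp_le[OF g_pos])

lemma w_le_1:
  assumes "0 < r" "r < 1"
  shows "w r \<le> 1"
proof -
  have "eventually (\<lambda>s. w r \<le> w s) (at_right 0)"
    using assms by (auto simp: eventually_at_right_field intro!: exI[of _ r] w_antimono)
  then show ?thesis
    using tendsto_lowerbound[OF w_lim_0] by simp
qed

lemma g_mono:
  assumes "0 < r" "r \<le> s" "s < 1"
  shows "g r \<le> g s"
proof (rule DERIV_nonneg_imp_nondecreasing[OF assms(2)])
  fix x assume "r \<le> x" "x \<le> s"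
  then have "0 < x" "x < 1" using assms by auto
  then show "\<exists>y. (g has_real_derivative y) (at x) \<and> 0 \<le> y"
    using alpha
    by (intro exI[of _ "\<alpha> * x powr (\<alpha> * k - 1) * (\<mu> * w x) powr k * g x powr (1 - k)"]
        conjI g_deriv) auto
qed

text \<open>The exponent is free because two choices matter: \<open>c = k\<close> removes
  \<open>g\<close> from the right-hand side, while a smaller exponent, taken from another solution,
  leaves a negative power of \<open>g\<close> that can be estimated.\<close>

lemma g_powr_deriv:
  assumes "0 < r" "r < 1"
  shows "((\<lambda>r. g r powr c) has_real_derivative
    c * \<alpha> * r powr (\<alpha> * k - 1) * (\<mu> * w r) powr k * g r powr (c - k)) (at r)"
proof -
  have eq: "g r powr (c - k) = g r powr (c - 1) * g r powr (1 - k)"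
    by (simp flip: powr_add)
  show ?thesis
    unfolding eq
    by (rule derivative_eq_intros g_deriv g_pos assms refl | simp)+
qed

lemma g_powr_lim_0:
  assumes "0 < c"
  shows "((\<lambda>r. g r powr c) \<longlongrightarrow> 0) (at_right 0)"
proof -
  have "eventually (\<lambda>r. 0 \<le> g r) (at_right 0)"
    by (auto simp: eventually_at_right_field intro!: exI[of _ 1] less_imp_le[OF g_pos])
  then show ?thesis
    using tendsto_powr'[OF g_lim_0 tendsto_const[of c]] assms by simp
qed

text \<open>\<open>r powr (- (\<alpha> * k)) * g r powr k\<close> is the average of the decreasing function
  \<open>(\<mu> * w) powr k\<close> over \<open>(0, r)\<close> with weight \<open>s powr (\<alpha> * k - 1)\<close>.\<close>

lemma g_ge:
  assumes "0 < r" "r < 1"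
  shows "r powr \<alpha> * (\<mu> * w r) \<le> g r"
proof -
  \<comment> \<open>The derivative of \<open>g powr k\<close> cancels the term that comes from
    differentiating \<open>r powr (\<alpha> * k)\<close>. Only the term with \<open>w'\<close>
    survives; it is \<open>h'\<close>, nonnegative since \<open>w\<close> decreases.\<close>
  define h where "h = (\<lambda>r. g r powr k - r powr (\<alpha> * k) * (\<mu> * w r) powr k)"
  define h' where "h' = (\<lambda>r. r powr (\<alpha> * k) * (k * (\<mu> * w r) powr (k - 1) *
    (\<mu> * (r powr (1 - \<alpha>) * g r))))"
  have ak: "0 < \<alpha> * k" using alpha k by simp
  have "0 \<le> h r"
  proof (rule nonneg_if_deriv_nonneg_tendsto_0[where h = h and h' = h' and r = r])
    fix s :: real assume s: "0 < s" "s < 1"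
    have pos: "0 < \<mu> * w s" using mu w_pos[OF s] by simp
    have dw: "((\<lambda>r. (\<mu> * w r) powr k) has_real_derivative
        k * (\<mu> * w s) powr (k - 1) * (\<mu> * - (s powr (1 - \<alpha>) * g s))) (at s)"
      by (rule derivative_eq_intros w_deriv s pos refl | simp)+
    have dr: "((\<lambda>r. r powr (\<alpha> * k)) has_real_derivative \<alpha> * k * s powr (\<alpha> * k - 1)) (at s)"
      by (rule derivative_eq_intros s refl | simp)+
    show "(h has_real_derivative h' s) (at s)"
      unfolding h_def h'_def
      by (rule DERIV_cong[OF DERIV_diff[OF g_powr_deriv[OF s] DERIV_mult[OF dr dw]]])
         (use g_pos[OF s] in \<open>simp add: algebra_simps\<close>)
    show "0 \<le> h' s"
      unfolding h'_def using k mu less_imp_le[OF g_pos[OF s]] by simp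
  next
    have "((\<lambda>r::real. r powr (\<alpha> * k)) \<longlongrightarrow> 0) (at_right 0)"
      by (rule powr_tendsto_0_at_right[OF ak])
    moreover have "((\<lambda>r. (\<mu> * w r) powr k) \<longlongrightarrow> (\<mu> * 1) powr k) (at_right 0)"
      using mu by (intro tendsto_intros w_lim_0) auto
    ultimately have "(h \<longlongrightarrow> 0 - 0 * (\<mu> * 1) powr k) (at_right 0)"
      unfolding h_def using k by (intro tendsto_diff tendsto_mult g_powr_lim_0) auto
    then show "(h \<longlongrightarrow> 0) (at_right 0)" by simp
  qed (use assms in auto)
  then have "(r powr \<alpha> * (\<mu> * w r)) powr k \<le> g r powr k"
    using mu w_pos[OF assms] by (simp add: h_def powr_mult powr_powr)
  then show ?thesis
    by (rule le_if_powr_le[rotated 2]) (use k g_pos[OF assms] mu w_pos[OF assms] in auto)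
qed

text \<open>Bounds \<open>g\<close> from below by a multiple of the natural growth
  \<open>r powr \<alpha>\<close> up to both endpoints, so that another flux can be divided by it.
  Near 0 this is \<open>g_ge\<close> with \<open>w\<close> bounded below by its value at 1/2; beyond
  1/2 the monotonicity of \<open>g\<close> suffices.\<close>

lemma g_lower_bound:
  obtains m where "0 < m" "\<And>r. 0 < r \<Longrightarrow> r < 1 \<Longrightarrow> m * r powr \<alpha> \<le> g r"
proof
  define m where "m = min (\<mu> * w (1 / 2)) (g (1 / 2))"
  show "0 < m" unfolding m_def using mu w_pos g_pos by simp
  fix r :: real assume r: "0 < r" "r < 1"
  show "m * r powr \<alpha> \<le> g r"
  proof (cases "r \<le> 1 / 2")
    case True
    then have "m \<le> \<mu> * w r"
      unfolding m_def using r mu w_antimono[of r "1 / 2"] by (intro min.coboundedI1) simp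
    then have "m * r powr \<alpha> \<le> (\<mu> * w r) * r powr \<alpha>" by (rule mult_right_mono) simp
    also have "\<dots> \<le> g r" using g_ge[OF r] by (simp add: mult.commute)
    finally show ?thesis .
  next
    case False
    have "m * r powr \<alpha> \<le> m * 1"
      using \<open>0 < m\<close> r alpha by (intro mult_left_mono powr_le1) auto
    also have "\<dots> \<le> g (1 / 2)" by (simp add: m_def)
    also have "\<dots> \<le> g r" using False r by (intro g_mono) auto
    finally show ?thesis .
  qed
qed

text \<open>Raising the inequality \<open>g_ge\<close> to the negative power \<open>j - k\<close> shows that a solution for
  \<open>k\<close> is a subsolution for every smaller exponent \<open>j\<close>.\<close>

lemma g_powr_deriv_le:
  assumes "0 < r" "r < 1" "0 \<le> j" "j \<le> k"
  shows "j * \<alpha> * r powr (\<alpha> * k - 1) * (\<mu> * w r) powr k * g r powr (j - k)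
    \<le> j * \<alpha> * r powr (\<alpha> * j - 1) * (\<mu> * w r) powr j"
proof -
  let ?m = "\<mu> * w r"
  have pos: "0 < ?m" using mu w_pos assms by simp
  have "g r powr (j - k) \<le> (r powr \<alpha> * ?m) powr (j - k)"
    using assms pos by (intro powr_mono2' g_ge) auto
  also have "\<dots> = r powr (\<alpha> * j - \<alpha> * k) * ?m powr (j - k)"
    using pos by (simp add: powr_mult powr_powr right_diff_distrib)
  finally have "j * \<alpha> * r powr (\<alpha> * k - 1) * ?m powr k * g r powr (j - k) \<le>
    j * \<alpha> * r powr (\<alpha> * k - 1) * ?m powr k * (r powr (\<alpha> * j - \<alpha> * k) * ?m powr (j - k))"
    using assms alpha by (intro mult_left_mono) auto
  also have "\<dots> = j * \<alpha> * (r powr (\<alpha> * k - 1) * r powr (\<alpha> * j - \<alpha> * k)) *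
    (?m powr k * ?m powr (j - k))"
    by (simp add: mult_ac)
  also have "\<dots> = j * \<alpha> * r powr (\<alpha> * j - 1) * ?m powr j"
    by (simp flip: powr_add)
  finally show ?thesis .
qed

end

section \<open>Comparison of two solutions\<close>

text \<open>Both solutions share \<open>\<alpha>\<close>, so the same weight
  \<open>r powr (1 - \<alpha>)\<close> links each function to its flux.\<close>

locale radial_solution_pair =
  K: radial_solution \<alpha> k \<mu> w g + L: radial_solution \<alpha> l \<nu> z h
  for \<alpha> k \<mu> w g l \<nu> z h +
  assumes kl: "k \<le> l"
begin

text \<open>The integration from 1: the flux bound makes \<open>z - c * w\<close> nondecreasing, and
  this difference vanishes at 1.\<close>

lemma le_if_flux_le:
  assumes flux: "\<And>r. 0 < r \<Longrightarrow> r < 1 \<Longrightarrow> h r \<le> c * g r" and r: "0 < r" "r < 1"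
  shows "z r \<le> c * w r"
proof -
  have "z r - c * w r \<le> 0"
  proof (rule nonpos_if_deriv_nonneg_tendsto_0[where r = r and h = "\<lambda>r. z r - c * w r" and
        h' = "\<lambda>r. r powr (1 - \<alpha>) * (c * g r - h r)"])
    fix s :: real assume s: "0 < s" "s < 1"
    show "((\<lambda>r. z r - c * w r) has_real_derivative s powr (1 - \<alpha>) * (c * g s - h s)) (at s)"
      by (auto intro!: derivative_eq_intros K.w_deriv[OF s] L.w_deriv[OF s] simp: algebra_simps)
    show "0 \<le> s powr (1 - \<alpha>) * (c * g s - h s)" using flux[OF s] by simp
  next
    have "((\<lambda>r. z r - c * w r) \<longlongrightarrow> 0 - c * 0) (at_left 1)"
      by (intro tendsto_intros K.w_lim_1 L.w_lim_1)
    then show "((\<lambda>r. z r - c * w r) \<longlongrightarrow> 0) (at_left 1)" by simp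
  qed (use r in auto)
  then show ?thesis by simp
qed

text \<open>Start of the iteration. Since \<open>z \<le> 1\<close>, integrating the equation for
  \<open>h powr l\<close> from 0 gives \<open>h r \<le> \<nu> * r powr \<alpha>\<close>; with the
  lower bound \<open>m * r powr \<alpha>\<close> for \<open>g\<close> this yields
  \<open>C = \<nu> / m\<close>.\<close>

lemma ex_le:
  obtains C where "0 < C" "\<And>r. 0 < r \<Longrightarrow> r < 1 \<Longrightarrow> z r \<le> C * w r"
proof -
  obtain m where m: "0 < m" "\<And>r. 0 < r \<Longrightarrow> r < 1 \<Longrightarrow> m * r powr \<alpha> \<le> g r"
    using K.g_lower_bound by blast
  have upper: "h r \<le> \<nu> * r powr \<alpha>" if r: "0 < r" "r < 1" for r
  proof -
    \<comment> \<open>The derivative of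
      \<open>(\<nu> * r powr \<alpha>) powr l - h r powr l\<close>: the comparison flux is the one
      obtained by replacing \<open>z\<close> by 1.\<close>
    define D where "D = (\<lambda>r. l * \<alpha> * r powr (\<alpha> * l - 1) * (\<nu> powr l - (\<nu> * z r) powr l))"
    have al: "0 < \<alpha> * l" using L.alpha L.k by simp
    have "0 \<le> \<nu> powr l * r powr (\<alpha> * l) - h r powr l"
    proof (rule nonneg_if_deriv_nonneg_tendsto_0[where h' = D and r = r and
          h = "\<lambda>r. \<nu> powr l * r powr (\<alpha> * l) - h r powr l"])
      fix s :: real assume s: "0 < s" "s < 1"
      have dr: "((\<lambda>r. r powr (\<alpha> * l)) has_real_derivative \<alpha> * l * s powr (\<alpha> * l - 1)) (at s)"
        by (rule derivative_eq_intros s refl | simp)+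
      show "((\<lambda>r. \<nu> powr l * r powr (\<alpha> * l) - h r powr l) has_real_derivative D s) (at s)"
        unfolding D_def
        by (rule DERIV_cong[OF DERIV_diff[OF DERIV_cmult[OF dr] L.g_powr_deriv[OF s]]])
           (use L.g_pos[OF s] in \<open>simp add: algebra_simps\<close>)
      have "(\<nu> * z s) powr l \<le> \<nu> powr l"
        using L.mu L.k L.w_le_1[OF s] L.w_pos[OF s] by (intro powr_mono2) auto
      then show "0 \<le> D s" unfolding D_def using L.alpha L.k by simp
    next
      have "((\<lambda>r::real. r powr (\<alpha> * l)) \<longlongrightarrow> 0) (at_right 0)"
        by (rule powr_tendsto_0_at_right[OF al])
      then have "((\<lambda>r. \<nu> powr l * r powr (\<alpha> * l) - h r powr l) \<longlongrightarrow> \<nu> powr l * 0 - 0) (at_right 0)"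
        using L.k by (intro tendsto_intros L.g_powr_lim_0) auto
      then show "((\<lambda>r. \<nu> powr l * r powr (\<alpha> * l) - h r powr l) \<longlongrightarrow> 0) (at_right 0)" by simp
    qed (use r in auto)
    then have "h r powr l \<le> (\<nu> * r powr \<alpha>) powr l"
      using L.mu by (simp add: powr_mult powr_powr)
    then show ?thesis
      by (rule le_if_powr_le[rotated 2]) (use L.k L.mu L.g_pos[OF r] in auto)
  qed
  have "h r \<le> (\<nu> / m) * g r" if r: "0 < r" "r < 1" for r
  proof -
    have "h r \<le> (\<nu> / m) * (m * r powr \<alpha>)" using upper[OF r] m(1) by simp
    also have "\<dots> \<le> (\<nu> / m) * g r" using m L.mu r by (intro mult_left_mono) auto
    finally show ?thesis .
  qed
  then have "z r \<le> (\<nu> / m) * w r" if "0 < r" "r < 1" for r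
    using le_if_flux_le that by blast
  then show thesis using that[of "\<nu> / m"] m(1) L.mu by simp
qed

text \<open>One round of the iteration: the bound on \<open>z\<close> is inserted into the equations
  for the \<open>k\<close>-th powers of the fluxes, these are integrated from 0, and
  \<open>le_if_flux_le\<close> returns to the functions.\<close>

lemma le_improve:
  assumes C: "0 < C" and le: "\<And>r. 0 < r \<Longrightarrow> r < 1 \<Longrightarrow> z r \<le> C * w r"
    and r: "0 < r" "r < 1"
  shows "z r \<le> (C * (\<nu> / \<mu>)) * w r"
proof (rule le_if_flux_le[OF _ r])
  fix r :: real assume r: "0 < r" "r < 1"
  \<comment> \<open>Chosen so that \<open>\<nu> * (C * w)\<close> equals
    \<open>c * (\<mu> * w)\<close>, which turns the bound on \<open>z\<close> into one between the
    two right-hand sides.\<close>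
  define c where "c = C * (\<nu> / \<mu>)"
  have c: "0 < c" unfolding c_def using C K.mu L.mu by simp
  define D where "D = (\<lambda>r. c powr k * (k * \<alpha> * r powr (\<alpha> * k - 1) * (\<mu> * w r) powr k * g r powr (k - k))
    - k * \<alpha> * r powr (\<alpha> * l - 1) * (\<nu> * z r) powr l * h r powr (k - l))"
  have "0 \<le> c powr k * g r powr k - h r powr k"
  proof (rule nonneg_if_deriv_nonneg_tendsto_0[where h' = D and r = r and
        h = "\<lambda>r. c powr k * g r powr k - h r powr k"])
    fix s :: real assume s: "0 < s" "s < 1"
    show "((\<lambda>r. c powr k * g r powr k - h r powr k) has_real_derivative D s) (at s)"
      unfolding D_def
      by (intro DERIV_diff DERIV_cmult K.g_powr_deriv L.g_powr_deriv s)
    have "\<nu> * z s \<le> \<nu> * (C * w s)"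
      using le[OF s] L.mu by (intro mult_left_mono) auto
    also have "\<dots> = c * (\<mu> * w s)" unfolding c_def using K.mu by simp
    finally have "(\<nu> * z s) powr k \<le> (c * (\<mu> * w s)) powr k"
      using K.k L.mu L.w_pos[OF s] by (intro powr_mono2) auto
    then have "(\<nu> * z s) powr k \<le> c powr k * (\<mu> * w s) powr k"
      using c K.mu K.w_pos[OF s] by (simp add: powr_mult)
    then have "k * \<alpha> * s powr (\<alpha> * k - 1) * (\<nu> * z s) powr k \<le>
        k * \<alpha> * s powr (\<alpha> * k - 1) * (c powr k * (\<mu> * w s) powr k)"
      using K.k K.alpha by (intro mult_left_mono) auto
    \<comment> \<open>Positivity of \<open>g\<close> matters here, because
      \<open>0 powr 0 = 0\<close>.\<close>
    moreover have "g s powr (k - k) = 1" using K.g_pos[OF s] by simp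
    \<comment> \<open>The subsolution estimate with \<open>j = k\<close> replaces the exponent
      \<open>l\<close> by \<open>k\<close> in the term from \<open>h\<close>.\<close>
    ultimately show "0 \<le> D s"
      unfolding D_def using L.g_powr_deriv_le[OF s _ kl] K.k by (simp add: mult_ac)
  next
    have "((\<lambda>r. c powr k * g r powr k - h r powr k) \<longlongrightarrow> c powr k * 0 - 0) (at_right 0)"
      using K.k by (intro tendsto_intros L.g_powr_lim_0 K.g_powr_lim_0) auto
    then show "((\<lambda>r. c powr k * g r powr k - h r powr k) \<longlongrightarrow> 0) (at_right 0)" by simp
  qed (use r in auto)
  then have "h r powr k \<le> (c * g r) powr k"
    using c K.g_pos[OF r] by (simp add: powr_mult)
  then show "h r \<le> (C * (\<nu> / \<mu>)) * g r"
    unfolding c_def[symmetric]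
    by (rule le_if_powr_le[rotated 2]) (use K.k c K.g_pos[OF r] L.g_pos[OF r] in auto)
qed

lemma eigenvalue_le: "\<mu> \<le> \<nu>"
proof (rule ccontr)
  assume "\<not> \<mu> \<le> \<nu>"
  define \<rho> where "\<rho> = \<nu> / \<mu>"
  have rho: "0 < \<rho>" "\<rho> < 1"
    unfolding \<rho>_def using \<open>\<not> \<mu> \<le> \<nu>\<close> K.mu L.mu by auto
  obtain C where C: "0 < C" "\<And>r. 0 < r \<Longrightarrow> r < 1 \<Longrightarrow> z r \<le> C * w r"
    using ex_le by blast
  have bound: "z r \<le> (C * \<rho> ^ n) * w r" if "0 < r" "r < 1" for n r
    using that
  \<comment> \<open>Each round integrates over the interval, so the hypothesis must hold at every
    point.\<close>
  proof (induction n arbitrary: r)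
    case 0
    then show ?case using C by simp
  next
    case (Suc n)
    have "z r \<le> (C * \<rho> ^ n * (\<nu> / \<mu>)) * w r"
      using C(1) rho Suc by (intro le_improve) auto
    then show ?case by (simp add: \<rho>_def mult_ac)
  qed
  have "(\<lambda>n. (C * \<rho> ^ n) * w (1 / 2)) \<longlonglongrightarrow> (C * 0) * w (1 / 2)"
    using rho by (intro tendsto_intros LIMSEQ_realpow_zero) auto
  then have "z (1 / 2) \<le> (C * 0) * w (1 / 2)"
    by (rule LIMSEQ_le_const) (use bound in auto)
  then show False using L.w_pos[of "1 / 2"] by simp
qed

end

section \<open>From eigenpairs to the first-order system\<close>

lemma real_binomial_pos:
  assumes "0 \<le> k" "k \<le> n"
  shows "0 < real_binomial n k"
  using assms by (simp add: real_binomial_def Gamma_real_pos)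

text \<open>The functional equation of Gamma; the factor \<open>Gamma (n - k + 1)\<close> is common
  to both sides. For \<open>n = \<alpha> * k\<close> it expresses the coefficient in
  \<open>S_op\<close> through the binomial in the theorem.\<close>

lemma real_binomial_absorption:
  assumes "0 < k" "k \<le> n"
  shows "real_binomial n k = n / k * real_binomial (n - 1) (k - 1)"
proof -
  have "Gamma (n + 1) = n * Gamma n" "Gamma (k + 1) = k * Gamma k"
    using assms by (auto intro!: Gamma_plus1 dest: nonpos_Ints_nonpos)
  then show ?thesis by (simp add: real_binomial_def)
qed

text \<open>The main work is strictness: alpha-convexity gives only weak inequalities, and the
  boundary values together with the equation make \<open>- u\<close> and the flux positive, so that
  the equation can be solved for the derivative of the flux.\<close>

lemma radial_solution_if_eigenpair:
  assumes alpha: "1 \<le> \<alpha>" and k: "1 \<le> k" and pair: "radial_eigenpair k (\<alpha> * k) u lam"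
  shows "radial_solution \<alpha> k (real_binomial (\<alpha> * k) k powr (- 1 / k) * lam)
    (\<lambda>r. - u r) (\<lambda>r. r powr (\<alpha> - 1) * deriv u r)"
proof -
  define B where "B = real_binomial (\<alpha> * k) k"
  define \<mu> where "\<mu> = B powr (- 1 / k) * lam"
  define g where "g = (\<lambda>r. r powr (\<alpha> - 1) * deriv u r)"
  \<comment> \<open>The second-order factor of \<open>S_op\<close>; the flux satisfies
    \<open>g' = r powr (\<alpha> - 1) * A\<close>.\<close>
  define A where "A = (\<lambda>r. deriv (deriv u) r + (\<alpha> - 1) * (deriv u r / r))"
  have kak: "k \<le> \<alpha> * k" using alpha k by simp
  have Bpos: "0 < B" unfolding B_def using k kak by (intro real_binomial_pos) auto
  have B': "real_binomial (\<alpha> * k - 1) (k - 1) = B / \<alpha>"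
    unfolding B_def using k kak alpha by (subst real_binomial_absorption) auto
  have "(\<alpha> * k) / k = \<alpha>" "(\<alpha> * k - k) / k = \<alpha> - 1" using k by (auto simp: field_simps)
  note pair = pair[unfolded radial_eigenpair_def alpha_convex_def C2_on_def S_op_def B' this]
  have lam: "0 < lam" and lim0: "(u \<longlongrightarrow> - 1) (at_right 0)" and lim1: "(u \<longlongrightarrow> 0) (at_left 1)"
    and limsup: "Limsup (at_right 0) (\<lambda>r. ereal (deriv u r / r)) < \<infinity>"
    using pair by auto
  have u'_nonneg: "0 \<le> deriv u r" and A_nonneg: "0 \<le> A r"
    and eq: "B / \<alpha> * rpow (deriv u r / r) (k - 1) * A r = rpow (- lam * u r) k"
    if "0 < r" "r < 1" for r
    using pair that by (auto simp: A_def)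
  have u_deriv: "(u has_real_derivative deriv u r) (at r)"
    and u'_deriv: "(deriv u has_real_derivative deriv (deriv u) r) (at r)" if "0 < r" "r < 1" for r
    using pair that
    by (auto simp: differentiable_on_eq_differentiable_at DERIV_deriv_iff_real_differentiable)
  have g_deriv: "(g has_real_derivative r powr (\<alpha> - 1) * A r) (at r)" if r: "0 < r" "r < 1" for r
  proof -
    have "(g has_real_derivative (\<alpha> - 1) * r powr (\<alpha> - 1 - 1) * deriv u r
        + deriv (deriv u) r * r powr (\<alpha> - 1)) (at r)"
      unfolding g_def using r by (auto intro!: derivative_eq_intros u'_deriv)
    moreover have "r powr (\<alpha> - 1 - 1) = r powr (\<alpha> - 1) / r"
      using r by (simp add: powr_diff power2_eq_square)
    ultimately show ?thesis by (simp add: A_def distrib_left mult_ac add.commute)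
  qed
  have g_nonneg: "0 \<le> g r" if "0 < r" "r < 1" for r
    using u'_nonneg[OF that] by (simp add: g_def)
  have g_mono: "g r \<le> g s" if "0 < r" "r \<le> s" "s < 1" for r s
    using that
    by (intro DERIV_nonneg_imp_nondecreasing[OF that(2)])
       (force intro!: g_deriv simp: A_nonneg)
  have u_nonpos: "u r \<le> 0" if "0 < r" "r < 1" for r
    by (rule nonpos_if_deriv_nonneg_tendsto_0[OF u_deriv u'_nonneg lim1 that])
  have u_neg: "u r < 0" if r: "0 < r" "r < 1" for r
  proof (rule ccontr)
    assume "\<not> u r < 0"
    then have u0: "u r = 0" using u_nonpos[OF r] by simp
    \<comment> \<open>A zero of \<open>u\<close> would be an interior maximum. There the
      nonnegative, nondecreasing \<open>g\<close> vanishes, hence also on all of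
      \<open>(0, r]\<close>; then \<open>u\<close> is identically 0 near 0, against the limit
      -1.\<close>
    have "deriv u r = 0"
    proof (rule DERIV_local_max[OF u_deriv[OF r]])
      show "0 < min r (1 - r)" using r by simp
      show "\<forall>y. \<bar>r - y\<bar> < min r (1 - r) \<longrightarrow> u y \<le> u r"
        unfolding u0 by (auto intro!: u_nonpos)
    qed
    then have gr: "g r = 0" by (simp add: g_def)
    have u'0: "deriv u s = 0" if "0 < s" "s \<le> r" for s
    proof -
      have "g s = 0" using g_mono[of s r] g_nonneg[of s] gr that r by auto
      then show ?thesis using that by (simp add: g_def)
    qed
    have "u s = 0" if s: "0 < s" "s \<le> r" for s
    proof -
      have "u r \<le> u s"
        using s r u'0 by (intro DERIV_nonpos_imp_nonincreasing[OF s(2)])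
          (metis le_less_trans less_le_trans order_refl u_deriv)
      then show ?thesis using u0 u_nonpos[of s] s r by auto
    qed
    then have "eventually (\<lambda>s. u s = 0) (at_right 0)"
      using r by (auto simp: eventually_at_right_field intro!: exI[of _ r])
    then have "(u \<longlongrightarrow> 0) (at_right 0)" by (rule tendsto_eventually)
    then show False using tendsto_unique[OF _ lim0] by force
  qed
  have rhs_pos: "0 < - lam * u r" if "0 < r" "r < 1" for r
    using lam u_neg[OF that] by (simp add: mult_pos_neg)
  have A_pos: "0 < A r" if r: "0 < r" "r < 1" for r
  proof -
    have "rpow (- lam * u r) k \<noteq> 0" using rhs_pos[OF r] k by (auto simp: rpow_def)
    then have "A r \<noteq> 0" using eq[OF r] by auto
    then show ?thesis using A_nonneg[OF r] by simp
  qed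
  have g_pos: "0 < g r" if r: "0 < r" "r < 1" for r
  proof -
    \<comment> \<open>Positive \<open>A\<close> makes \<open>g\<close> strictly increasing, so
      nonnegativity at \<open>r / 2\<close> becomes positivity at \<open>r\<close>.\<close>
    have "g (r / 2) < g r"
    proof (rule DERIV_pos_imp_increasing[where f = g])
      fix x assume "r / 2 \<le> x" "x \<le> r"
      then have x: "0 < x" "x < 1" using r by auto
      then show "\<exists>y. (g has_real_derivative y) (at x) \<and> 0 < y"
        using g_deriv[OF x] A_pos[OF x] by (intro exI[of _ "x powr (\<alpha> - 1) * A x"]) auto
    qed (use r in auto)
    then show ?thesis using g_nonneg[of "r / 2"] r by auto
  qed
  have A_eq: "A r = \<alpha> * r powr (\<alpha> * k - \<alpha>) * (\<mu> * - u r) powr k * g r powr (1 - k)"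
    if r: "0 < r" "r < 1" for r
  proof -
    define p where "p = deriv u r / r"
    have u': "0 < deriv u r" using g_pos[OF r] by (simp add: g_def zero_less_mult_iff)
    then have p: "0 < p" using r by (simp add: p_def)
    have "g r = r powr \<alpha> * p"
      using r by (simp add: g_def p_def powr_diff)
    then have gp: "g r powr (1 - k) = r powr (\<alpha> - \<alpha> * k) * p powr (1 - k)"
      using p by (simp add: powr_mult powr_powr right_diff_distrib)
    \<comment> \<open>For \<open>k = 1\<close> the two sides agree because \<open>p\<close> is
      nonzero.\<close>
    have "rpow p (k - 1) = p powr (k - 1)" using p by (simp add: rpow_def)
    then have eq': "B / \<alpha> * p powr (k - 1) * A r = (- lam * u r) powr k"
      using eq[OF r] k by (simp add: p_def rpow_def)
    have inv: "p powr (1 - k) = 1 / p powr (k - 1)"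
      using powr_minus_divide[of p "k - 1"] by simp
    have A: "A r = \<alpha> / B * (- lam * u r) powr k * p powr (1 - k)"
      unfolding eq'[symmetric] inv using Bpos alpha p by simp
    have mu: "(\<mu> * - u r) powr k = (B powr (- 1 / k)) powr k * (- lam * u r) powr k"
      using rhs_pos[OF r] Bpos by (simp add: \<mu>_def mult.assoc flip: powr_mult)
    have B_inv: "(B powr (- 1 / k)) powr k = 1 / B"
      using k Bpos powr_minus_divide[of B 1] by (simp add: powr_powr)
    have r_inv: "r powr (\<alpha> * k - \<alpha>) = 1 / r powr (\<alpha> - \<alpha> * k)"
      using powr_minus_divide[of r "\<alpha> - \<alpha> * k"] by simp
    show ?thesis unfolding A mu B_inv r_inv gp using r by simp
  qed
  have g_lim: "(g \<longlongrightarrow> 0) (at_right 0)"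
  proof -
    \<comment> \<open>The limsup condition gives \<open>deriv u r \<le> M * r\<close> near 0. This
      forces the limit 0 even for \<open>\<alpha> = 1\<close>, where the weight in \<open>g\<close>
      is 1.\<close>
    obtain M where "Limsup (at_right 0) (\<lambda>r. ereal (deriv u r / r)) < ereal M"
      using limsup ereal_dense2 by blast
    from Limsup_lessD[OF this] have "eventually (\<lambda>r. deriv u r / r < M) (at_right 0)"
      by simp
    moreover have "eventually (\<lambda>r::real. 0 < r \<and> r < 1) (at_right 0)"
      by (auto simp: eventually_at_right_field intro!: exI[of _ 1])
    ultimately have "eventually (\<lambda>r. g r \<le> M * r) (at_right 0)"
    proof eventually_elim
      case (elim r)
      have "g r \<le> 1 * deriv u r"
        unfolding g_def using elim alpha u'_nonneg[of r]
        by (intro mult_right_mono powr_le1) auto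
      also have "\<dots> \<le> M * r" using elim by (simp add: field_simps)
      finally show ?case .
    qed
    moreover have "eventually (\<lambda>r. 0 \<le> g r) (at_right 0)"
      by (auto simp: eventually_at_right_field intro!: exI[of _ 1] g_nonneg)
    moreover have "((\<lambda>r. M * r) \<longlongrightarrow> M * 0) (at_right 0)"
      by (intro tendsto_intros)
    ultimately show ?thesis
      using tendsto_sandwich[of "\<lambda>_. 0" g "at_right 0" "\<lambda>r. M * r" 0] by simp
  qed
  have "radial_solution \<alpha> k \<mu> (\<lambda>r. - u r) g"
  proof
    fix r :: real assume r: "0 < r" "r < 1"
    show "0 < - u r" using u_neg[OF r] by simp
    show "0 < g r" by (rule g_pos[OF r])
    have "r powr (1 - \<alpha>) * g r = deriv u r"
      unfolding g_def using r by (simp flip: powr_add mult.assoc)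
    then show "((\<lambda>r. - u r) has_real_derivative - (r powr (1 - \<alpha>) * g r)) (at r)"
      by (simp add: DERIV_minus u_deriv[OF r])
    have "r powr (\<alpha> - 1) * A r =
      \<alpha> * (r powr (\<alpha> - 1) * r powr (\<alpha> * k - \<alpha>)) * (\<mu> * - u r) powr k * g r powr (1 - k)"
      by (simp add: A_eq[OF r])
    also have "r powr (\<alpha> - 1) * r powr (\<alpha> * k - \<alpha>) = r powr (\<alpha> * k - 1)"
      by (simp flip: powr_add)
    finally show "(g has_real_derivative
      \<alpha> * r powr (\<alpha> * k - 1) * (\<mu> * - u r) powr k * g r powr (1 - k)) (at r)"
      using g_deriv[OF r] by simp
  next
    show "0 < \<mu>" unfolding \<mu>_def using Bpos lam by simp
    show "((\<lambda>r. - u r) \<longlongrightarrow> 1) (at_right 0)" using tendsto_minus[OF lim0] by simp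
    show "((\<lambda>r. - u r) \<longlongrightarrow> 0) (at_left 1)" using tendsto_minus[OF lim1] by simp
  qed (fact alpha k g_lim)+
  then show ?thesis by (simp add: \<mu>_def B_def g_def)
qed

theorem theorem1p3:
  fixes \<alpha> k l lam_k lam_l :: real
  assumes "\<alpha> \<ge> 1" and "1 \<le> k" and "k < l"
    and "is_first_radial_eigenvalue k (\<alpha> * k) lam_k"
    and "is_first_radial_eigenvalue l (\<alpha> * l) lam_l"
  shows "real_binomial (\<alpha> * k) k powr (- 1 / k) * lam_k
           \<le> real_binomial (\<alpha> * l) l powr (- 1 / l) * lam_l"
proof -
  obtain u v where "radial_eigenpair k (\<alpha> * k) u lam_k" "radial_eigenpair l (\<alpha> * l) v lam_l"
    using assms by (auto simp: is_first_radial_eigenvalue_def)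
  then interpret radial_solution_pair \<alpha> k "real_binomial (\<alpha> * k) k powr (- 1 / k) * lam_k"
    "\<lambda>r. - u r" "\<lambda>r. r powr (\<alpha> - 1) * deriv u r" l
    "real_binomial (\<alpha> * l) l powr (- 1 / l) * lam_l" "\<lambda>r. - v r" "\<lambda>r. r powr (\<alpha> - 1) * deriv v r"
    using assms
    by (intro radial_solution_pair.intro radial_solution_pair_axioms.intro
        radial_solution_if_eigenpair) auto
  show ?thesis by (rule eigenvalue_le)
qed

end
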